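(* Let $P$ be a simple $d$-polytope with $d\ge 3$, and let $\mathcal{O}$ be an acyclic orientation of $\mathcal{G}_P$. Then exactly one of the following two cases occurs: (a) there is a $2$-system $\mathcal{S}$ of $\mathcal{G}_P$ with $|\mathcal{S}|=\mathcal{H}_2(\mathcal{O})$; (b) there is an acyclic orientation $\mathcal{O}'$ of $\mathcal{G}_P$ with $\mathcal{H}_2(\mathcal{O}')<\mathcal{H}_2(\mathcal{O})$. In case (a), $\mathcal{O}$ is an AOF-orientation; in case (b), $\mathcal{O}$ is not an AOF-orientation.
   Context: A $d$-polytope $P$ is simple if every vertex of $P$ is contained in exactly $d$ edges. $\mathcal{G}_P=(\mathcal{V}(P),\mathcal{E}(P))$ denotes the abstract vertex-edge graph of $P$. For $W\subseteq\mathcal{V}(P)$, $\mathcal{G}_P(W)$ is the subgraph of $\mathcal{G}_P$ induced by $W$. A $2$-frame of $P$ is a (not necessarily induced) subgraph of $\mathcal{G}_P$ isomorphic to the star $K_{1,2}$. A set $\mathcal{S}$ of non-empty subsets of $\mathcal{V}(P)$ is a $2$-system of $\mathcal{G}_P$ if for every $S\in\mathcal{S}$ the induced subgraph $\mathcal{G}_P(S)$ is $2$-regular, and the node set of every $2$-frame of $P$ is contained in a unique set from $\mathcal{S}$. For an acyclic orientation $\mathcal{O}$ of $\mathcal{G}_P$ (no directed cycles) and $0\le i\le d$, $h_i(\mathcal{O})$ is the number of vertices of $\mathcal{G}_P$ with precisely $i$ of their incident edges directed inwards, and $\mathcal{H}_2(\mathcal{O})=\sum_{i=0}^d h_i(\mathcal{O})\binom{i}{2}$.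 An AOF-orientation of $\mathcal{G}_P$ is an acyclic orientation of $\mathcal{G}_P$ that induces a unique sink on every non-empty face of $P$ (including $P$ itself), where a sink induced on a face $F$ is a vertex of $F$ all of whose incident edges in the subgraph of $\mathcal{G}_P$ induced by the vertices of $F$ are directed towards it. *)

theory Defs
  imports "HOL-Analysis.Polytope"
begin

section \<open>Simple graphs\<close>

text \<open>A graph is a pair of a node set and a set of two-element sets of nodes.\<close>

type_synonym 'v ugraph = "'v set \<times> 'v set set"

definition nodes :: "'v ugraph \<Rightarrow> 'v set" where
  "nodes G = fst G"

definition edges :: "'v ugraph \<Rightarrow> 'v set set" where
  "edges G = snd G"

definition subgraph :: "'v ugraph \<Rightarrow> 'v ugraph \<Rightarrow> bool" where
  "subgraph H G \<longleftrightarrow> nodes H \<subseteq> nodes G \<and> edges H \<subseteq> edges G \<and> \<Union> (edges H) \<subseteq> nodes H"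

definition induced_subgraph :: "'v ugraph \<Rightarrow> 'v set \<Rightarrow> 'v ugraph" where
  "induced_subgraph G W = (nodes G \<inter> W, {e \<in> edges G. e \<subseteq> W})"

definition regular_graph :: "nat \<Rightarrow> 'v ugraph \<Rightarrow> bool" where
  "regular_graph k G \<longleftrightarrow> (\<forall>v \<in> nodes G. card {e \<in> edges G. v \<in> e} = k)"

definition isomorphic_graphs :: "'v ugraph \<Rightarrow> 'w ugraph \<Rightarrow> bool" where
  "isomorphic_graphs G H \<longleftrightarrow>
     (\<exists>f. bij_betw f (nodes G) (nodes H) \<and> edges H = (\<lambda>e. f ` e) ` edges G)"

text \<open>The star \<open>K\<^sub>1\<^sub>,\<^sub>k\<close> with centre \<open>0\<close>.\<close>

definition star_graph :: "nat \<Rightarrow> nat ugraph" where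
  "star_graph k = ({0..k}, {{0, i} |i. i \<in> {1..k}})"

section \<open>Orientations\<close>

text \<open>An orientation is given by its set of arcs; \<open>(u, v)\<close> means that the edge \<open>{u, v}\<close> is
  directed from \<open>u\<close> to \<open>v\<close>.\<close>

definition orientation :: "'v ugraph \<Rightarrow> ('v \<times> 'v) set \<Rightarrow> bool" where
  "orientation G \<O> \<longleftrightarrow>
     (\<forall>(u, v) \<in> \<O>. {u, v} \<in> edges G) \<and>
     (\<forall>u v. {u, v} \<in> edges G \<longrightarrow> ((u, v) \<in> \<O> \<longleftrightarrow> (v, u) \<notin> \<O>))"

definition acyclic_orientation :: "'v ugraph \<Rightarrow> ('v \<times> 'v) set \<Rightarrow> bool" where
  "acyclic_orientation G \<O> \<longleftrightarrow> orientation G \<O> \<and> acyclic \<O>"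

definition h_number :: "'v ugraph \<Rightarrow> ('v \<times> 'v) set \<Rightarrow> nat \<Rightarrow> nat" where
  "h_number G \<O> i = card {v \<in> nodes G. card {u. (u, v) \<in> \<O>} = i}"

definition is_sink :: "'v ugraph \<Rightarrow> ('v \<times> 'v) set \<Rightarrow> 'v \<Rightarrow> bool" where
  "is_sink G \<O> v \<longleftrightarrow> v \<in> nodes G \<and> (\<forall>u. {u, v} \<in> edges G \<longrightarrow> (u, v) \<in> \<O>)"

section \<open>Simple polytopes and their graphs\<close>

definition vertices_of :: "'a::euclidean_space set \<Rightarrow> 'a set" where
  "vertices_of P = {v. v extreme_point_of P}"

text \<open>No condition \<open>u \<noteq> v\<close> is needed below: an edge has affine dimension 1, and a face that is
  a segment has vertices of the polytope as its end points.\<close>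

definition polytope_graph :: "'a::euclidean_space set \<Rightarrow> 'a ugraph" where
  "polytope_graph P = (vertices_of P, {{u, v} |u v. closed_segment u v edge_of P})"

definition simple_polytope :: "nat \<Rightarrow> 'a::euclidean_space set \<Rightarrow> bool" where
  "simple_polytope d P \<longleftrightarrow>
     polytope P \<and> aff_dim P = int d \<and>
     (\<forall>v \<in> vertices_of P. card {e. e edge_of P \<and> v \<in> e} = d)"

definition two_frame :: "'a::euclidean_space set \<Rightarrow> 'a ugraph \<Rightarrow> bool" where
  "two_frame P H \<longleftrightarrow> subgraph H (polytope_graph P) \<and> isomorphic_graphs (star_graph 2) H"

definition two_system :: "'a::euclidean_space set \<Rightarrow> 'a set set \<Rightarrow> bool" where
  "two_system P \<S> \<longleftrightarrow>
     (\<forall>S \<in> \<S>. S \<noteq> {} \<and> S \<subseteq> vertices_of P \<and>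
        regular_graph 2 (induced_subgraph (polytope_graph P) S)) \<and>
     (\<forall>H. two_frame P H \<longrightarrow> (\<exists>!S. S \<in> \<S> \<and> nodes H \<subseteq> S))"

definition H2 :: "nat \<Rightarrow> 'a::euclidean_space set \<Rightarrow> ('a \<times> 'a) set \<Rightarrow> nat" where
  "H2 d P \<O> = (\<Sum>i = 0..d. h_number (polytope_graph P) \<O> i * (i choose 2))"

definition aof_orientation :: "'a::euclidean_space set \<Rightarrow> ('a \<times> 'a) set \<Rightarrow> bool" where
  "aof_orientation P \<O> \<longleftrightarrow>
     acyclic_orientation (polytope_graph P) \<O> \<and>
     (\<forall>F. F face_of P \<and> F \<noteq> {} \<longrightarrow>
        (\<exists>!v. is_sink (induced_subgraph (polytope_graph P) (vertices_of F)) \<O> v))"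

end

theory Submission
  imports Defs
begin

text \<open>
  Let \<open>f\<close> be the number of 2-faces of \<open>P\<close>; their vertex sets form a 2-system.
  Since \<open>H2 d P \<O>\<close> counts the 2-frames whose centre is a sink of the frame, and every member of a
  2-system \<open>\<S>\<close> contains such a frame, \<open>card \<S> \<le> H2 d P \<O>\<close>, with equality iff \<open>\<O>\<close> has a unique
  sink on every member of \<open>\<S>\<close>. A generic linear functional gives an AOF-orientation, for which
  \<open>H2\<close> therefore equals \<open>f\<close>. Hence case (a) means \<open>H2 d P \<O> = f\<close> and case (b) means \<open>H2 d P \<O> > f\<close>.
  Finally, unique sinks on the 2-faces imply unique sinks on all faces, by the argument of
  Newman's lemma: two arcs leaving a vertex span a 2-face, whose unique sink makes them confluent.
\<close>

section \<open>The cone of a polytope at a vertex\<close>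

definition neighbours :: "'a::euclidean_space set \<Rightarrow> 'a \<Rightarrow> 'a set" where
  "neighbours P v = {u. closed_segment v u edge_of P}"

lemma edge_endpoints:
  fixes P :: "'a::euclidean_space set"
  assumes "closed_segment u v edge_of P"
  shows "u \<noteq> v" "u extreme_point_of P" "v extreme_point_of P"
proof -
  show "u \<noteq> v" using assms by (auto simp: edge_of_def)
  show "u extreme_point_of P" "v extreme_point_of P"
    using assms extreme_point_of_face[of "closed_segment u v" P] extreme_point_of_segment
    by (auto simp: edge_of_def)
qed

text \<open>A compact convex collinear set is a segment, and a vertex of \<open>P\<close> lying on
  it is extreme in it, hence one of its ends. Edges at \<open>v\<close> can thus be named by their
  other end, as \<open>neighbours\<close> does.\<close>

lemma edge_of_polytope_segment:
  fixes P :: "'a::euclidean_space set"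
  assumes "polytope P" "e edge_of P" "v extreme_point_of P" "v \<in> e"
  obtains u where "e = closed_segment v u"
proof -
  have e: "e face_of P" "aff_dim e = 1" using assms(2) by (auto simp: edge_of_def)
  then have p: "polytope e" using assms(1) face_of_polytope_polytope by blast
  obtain a b where ab: "e = closed_segment a b"
    using compact_convex_collinear_segment[of e] p e assms(4)
    by (metis collinear_aff_dim empty_iff order_refl polytope_imp_compact polytope_imp_convex)
  have "v extreme_point_of e" using extreme_point_of_face[OF e(1)] assms by blast
  then have "v = a \<or> v = b" using ab extreme_point_of_segment by blast
  then show thesis using that ab closed_segment_commute by metis
qed

lemma edge_of_face:
  assumes "F face_of P"
  shows "e edge_of F \<longleftrightarrow> e edge_of P \<and> e \<subseteq> F"
  using face_of_face[OF assms] by (auto simp: edge_of_def)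

lemma neighbours_face:
  fixes P :: "'a::euclidean_space set"
  assumes "F face_of P" "v \<in> F"
  shows "neighbours F v = neighbours P v \<inter> F"
proof -
  have "closed_segment v u \<subseteq> F \<longleftrightarrow> u \<in> F" for u
    using closed_segment_subset[of v F u] assms(2) face_of_imp_convex[OF assms(1)] by auto
  then show ?thesis using edge_of_face[OF assms(1)] by (auto simp: neighbours_def)
qed

lemma finite_vertices:
  fixes P :: "'a::euclidean_space set"
  shows "polytope P \<Longrightarrow> finite (vertices_of P)"
  unfolding vertices_of_def by (simp add: finite_polyhedron_extreme_points polytope_imp_polyhedron)

lemma neighbours_subset: "neighbours P v \<subseteq> vertices_of P - {v}"
  using edge_endpoints by (auto simp: neighbours_def vertices_of_def)

lemma finite_neighbours: "polytope P \<Longrightarrow> finite (neighbours P v)"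
  using finite_vertices neighbours_subset finite_subset finite_Diff by metis

lemma polytope_eq_hull:
  fixes P :: "'a::euclidean_space set"
  shows "polytope P \<Longrightarrow> P = convex hull (vertices_of P)"
  unfolding vertices_of_def
  by (simp add: Krein_Milman_Minkowski polytope_imp_compact polytope_imp_convex)

text \<open>Descent through facets: a point of \<open>P\<close> outside the relative interior lies
  on a facet, and faces of facets are faces of \<open>P\<close>.\<close>

lemma ex_face_rel_interior:
  fixes P :: "'a::euclidean_space set"
  assumes "polytope P" "q \<in> P"
  obtains F where "F face_of P" "q \<in> rel_interior F"
  using assms
proof (induction "nat (aff_dim P + 1)" arbitrary: P thesis rule: less_induct)
  case less
  show thesis
  proof (cases "q \<in> rel_interior P")
    case True
    then show ?thesis using less.prems face_of_refl polytope_imp_convex by blast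
  next
    case False
    then have "q \<in> rel_frontier P"
      using less.prems closure_subset by (auto simp: rel_frontier_def)
    then obtain G where G: "G facet_of P" "q \<in> G"
      using rel_frontier_of_polyhedron[OF polytope_imp_polyhedron[OF less.prems(2)]] by auto
    have Gp: "G face_of P" "polytope G"
      using G less.prems face_of_polytope_polytope facet_of_imp_face_of by blast+
    \<comment> \<open>The shift by one in the measure keeps the decrease strict when
      \<open>P\<close> has dimension 0, where \<open>nat\<close> alone would give 0 for both
      dimensions.\<close>
    have "aff_dim P \<ge> 0" using less.prems
      by (metis aff_dim_negative_iff empty_iff not_le)
    then have "nat (aff_dim G + 1) < nat (aff_dim P + 1)" using G by (auto simp: facet_of_def)
    then obtain F where "F face_of G" "q \<in> rel_interior F"
      using less.hyps[OF _ _ Gp(2) G(2)] by blast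
    then show ?thesis using less.prems(1) Gp(1) face_of_trans by blast
  qed
qed

text \<open>Let \<open>F\<close> be the face with \<open>q\<close> in its relative interior. Being
  extreme and relatively interior in the slice of \<open>F\<close>, the point \<open>q\<close> is
  the whole slice. A hyperplane section of the affine hull of \<open>F\<close> loses at most one
  dimension, so \<open>F\<close> has dimension at most 1.\<close>

lemma extreme_point_of_slice:
  fixes P :: "'a::euclidean_space set"
  assumes "polytope P" "q extreme_point_of (P \<inter> {x. a \<bullet> x = h})"
  obtains F where "F face_of P" "q \<in> F" "aff_dim F \<le> 1"
proof -
  let ?H = "{x. a \<bullet> x = h}"
  have q: "q \<in> P" "q \<in> ?H" using assms(2) by (auto simp: extreme_point_of_def)
  obtain F where F: "F face_of P" "q \<in> rel_interior F"
    using ex_face_rel_interior[OF assms(1) q(1)] .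
  have cF: "convex F" using F(1) face_of_imp_convex by blast
  have qF: "q \<in> F" using F rel_interior_subset by blast
  have ri: "rel_interior (F \<inter> ?H) = rel_interior F \<inter> ?H"
    by (rule convex_affine_rel_interior_Int) (use cF F q affine_hyperplane in auto)
  have "q extreme_point_of (F \<inter> ?H)"
    using assms(2) F(1) qF face_of_imp_subset[OF F(1)] q(2) by (auto simp: extreme_point_of_def)
  then have "F \<inter> ?H = {q}"
    using extreme_point_not_in_REL_INTERIOR ri F(2) q(2) by blast
  \<comment> \<open>The slice of \<open>F\<close> contains a nonempty relatively open piece of the
    flat on the right, namely its intersection with the relative interior of \<open>F\<close>, and
    such a piece already spans the flat.\<close>
  moreover have "affine hull (F \<inter> ?H) = affine hull F \<inter> ?H"
  proof -
    let ?R = "rel_interior F"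
    have "affine hull ((affine hull F \<inter> ?H) \<inter> (affine hull F \<inter> ?H \<inter> ?R)) = affine hull (affine hull F \<inter> ?H)"
    proof (rule affine_hull_convex_Int_openin)
      show "convex (affine hull F \<inter> ?H)"
        by (simp add: affine_hyperplane affine_Int affine_imp_convex)
      obtain T where T: "open T" "?R = affine hull F \<inter> T"
        using openin_rel_interior[of F] by (auto simp: openin_open)
      then have "affine hull F \<inter> ?H \<inter> ?R = (affine hull F \<inter> ?H) \<inter> T" by blast
      then have "openin (top_of_set (affine hull F \<inter> ?H)) (affine hull F \<inter> ?H \<inter> ?R)"
        using T(1) by (metis openin_open_Int)
      moreover have "affine hull (affine hull F \<inter> ?H) = affine hull F \<inter> ?H"
        by (simp add: affine_Int affine_hyperplane hull_same)
      ultimately show "openin (top_of_set (affine hull (affine hull F \<inter> ?H))) (affine hull F \<inter> ?H \<inter> ?R)"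
        by (simp only:)
      show "(affine hull F \<inter> ?H) \<inter> (affine hull F \<inter> ?H \<inter> ?R) \<noteq> {}" using F q qF hull_inc by fastforce
    qed
    also have "\<dots> = affine hull F \<inter> ?H"
      by (simp add: affine_Int affine_hyperplane hull_same)
    finally have *: "affine hull (affine hull F \<inter> ?H \<inter> ?R) = affine hull F \<inter> ?H"
      by (metis Int_assoc inf.idem)
    show ?thesis
    proof
      show "affine hull (F \<inter> ?H) \<subseteq> affine hull F \<inter> ?H"
        by (rule hull_minimal) (use hull_subset[of F affine] in \<open>auto simp: affine_Int affine_hyperplane\<close>)
      have "affine hull F \<inter> ?H \<inter> ?R \<subseteq> F \<inter> ?H" using rel_interior_subset by blast
      then show "affine hull F \<inter> ?H \<subseteq> affine hull (F \<inter> ?H)"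
        using * hull_mono by metis
    qed
  qed
  ultimately have "aff_dim (affine hull F \<inter> ?H) = 0"
    using aff_dim_sing by (metis affine_hull_sing)
  then have "aff_dim (affine hull F) \<le> 1"
    by (subst (asm) aff_dim_affine_Int_hyperplane) (auto split: if_splits)
  then show thesis using that F(1) qF by (simp add: aff_dim_affine_hull)
qed

lemma convex_cone_hull_scaled_diff:
  fixes D :: "'a::euclidean_space set"
  assumes "q - v \<in> convex_cone hull D" "q = v + t *\<^sub>R (w - v)" "t > 0"
  shows "w - v \<in> convex_cone hull D"
proof -
  have "w - v = (1/t) *\<^sub>R (q - v)" using assms by simp
  then show ?thesis using assms convex_cone_hull_mul[of "q - v" D "1/t"]
    by simp
qed

text \<open>Cut off \<open>v\<close> by a hyperplane: the extreme points of the resulting vertex figure lie on the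
  edges through \<open>v\<close>, and every other vertex is seen from \<open>v\<close> through the vertex figure.\<close>

lemma polytope_subset_vertex_cone:
  fixes P :: "'a::euclidean_space set"
  assumes P: "polytope P" and v: "v \<in> vertices_of P" and x: "x \<in> P"
  shows "x - v \<in> convex_cone hull ((\<lambda>u. u - v) ` neighbours P v)"
proof -
  let ?C = "convex_cone hull ((\<lambda>u. u - v) ` neighbours P v)"
  have vP: "v \<in> P" using v by (auto simp: vertices_of_def extreme_point_of_def)
  have "{v} exposed_face_of P"
    using v by (simp add: exposed_face_of_polyhedron P polytope_imp_polyhedron vertices_of_def face_of_singleton)
  then obtain a b where ab: "P \<subseteq> {x. a \<bullet> x \<le> b}" "{v} = P \<inter> {x. a \<bullet> x = b}"
    by (auto simp: exposed_face_of_def)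
  have avb: "a \<bullet> v = b" using ab(2) by blast
  have less: "a \<bullet> w < b" if "w \<in> P" "w \<noteq> v" for w
    using ab that by force
  have shift: "convex {y. y - v \<in> ?C}"
  proof -
    have "{y. y - v \<in> ?C} = (+) v ` ?C"
      by (force simp: image_iff)
    then show ?thesis using convex_translation convex_convex_cone_hull by metis
  qed
  have vert: "w - v \<in> ?C" if w: "w \<in> vertices_of P" for w
  proof (cases "w = v")
    case True
    then show ?thesis by (simp add: convex_cone_hull_contains_0)
  next
    case False
    let ?W = "(\<lambda>w. a \<bullet> w) ` (vertices_of P - {v})"
    have fin: "finite ?W" using finite_vertices[OF P] by blast
    have sub: "vertices_of P \<subseteq> P" by (auto simp: vertices_of_def extreme_point_of_def)
    have ne: "?W \<noteq> {}" using False w by blast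
    have mb: "Max ?W < b" using fin ne sub less by auto
    \<comment> \<open>This level lies strictly between \<open>v\<close> and all other vertices, so
      the hyperplane \<open>?H\<close> at height \<open>h\<close> cuts off \<open>v\<close>
      alone.\<close>
    define h where "h = (Max ?W + b) / 2"
    have hb: "h < b" using mb by (simp add: h_def)
    have wh: "a \<bullet> w < h" if "w \<in> vertices_of P" "w \<noteq> v" for w
    proof -
      have "a \<bullet> w \<le> Max ?W" using fin that by (intro Max_ge) auto
      then show ?thesis using mb by (simp add: h_def)
    qed
    let ?Q = "P \<inter> {x. a \<bullet> x = h}"
    \<comment> \<open>A face of dimension at most 1 through \<open>q\<close> must have
      \<open>v\<close> as a vertex, since all other vertices lie below level \<open>h\<close>. As
      \<open>q\<close> differs from \<open>v\<close>, the face is an edge at \<open>v\<close>, and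
      \<open>q - v\<close> is a nonnegative multiple of its direction.\<close>
    have ext: "q - v \<in> ?C" if q: "q extreme_point_of ?Q" for q
    proof -
      obtain F where F: "F face_of P" "q \<in> F" "aff_dim F \<le> 1"
        using extreme_point_of_slice[OF P q] .
      have qh: "q \<in> P" "a \<bullet> q = h" using q by (auto simp: extreme_point_of_def)
      have pF: "polytope F" using F P face_of_polytope_polytope by blast
      have vF: "vertices_of F \<subseteq> vertices_of P"
        using extreme_point_of_face[OF F(1)] by (auto simp: vertices_of_def)
      have "\<exists>z \<in> vertices_of F. a \<bullet> z \<ge> h"
      proof (rule ccontr)
        assume "\<not> ?thesis"
        then have "vertices_of F \<subseteq> {x. a \<bullet> x < h}" by auto
        then have "convex hull (vertices_of F) \<subseteq> {x. a \<bullet> x < h}"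
          by (intro hull_minimal) (simp_all add: convex_halfspace_lt)
        then show False using polytope_eq_hull[OF pF] F(2) qh by blast
      qed
      then have vvF: "v \<in> vertices_of F" using wh vF by force
      then have "v \<in> F" by (auto simp: vertices_of_def extreme_point_of_def)
      moreover have "q \<noteq> v" using qh hb avb by auto
      ultimately have "F \<noteq> {}" "\<nexists>z. F = {z}" using F(2) by auto
      then have "aff_dim F = 1" using F(3)
        by (smt (verit) aff_dim_eq_0 aff_dim_negative_iff)
      then have "F edge_of P" using F by (simp add: edge_of_def)
      then obtain u where u: "F = closed_segment v u"
        using edge_of_polytope_segment[OF P _ _ \<open>v \<in> F\<close>] v by (auto simp: vertices_of_def)
      then have "u \<in> neighbours P v" using \<open>F edge_of P\<close> by (simp add: neighbours_def)
      then have "u - v \<in> ?C" using hull_inc by (metis imageI)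
      moreover obtain t where "0 \<le> t" "q - v = t *\<^sub>R (u - v)"
        using F(2) u by (auto simp: closed_segment_def algebra_simps)
      ultimately show ?thesis using convex_cone_hull_mul by metis
    qed
    have cQ: "compact ?Q" "convex ?Q"
      using P by (auto simp: polytope_imp_compact polytope_imp_convex compact_Int_closed
          closed_hyperplane convex_Int convex_hyperplane)
    have Qsub: "?Q \<subseteq> {y. y - v \<in> ?C}"
    proof -
      have "?Q = convex hull {q. q extreme_point_of ?Q}"
        by (rule Krein_Milman_Minkowski[OF cQ])
      moreover have "convex hull {q. q extreme_point_of ?Q} \<subseteq> {y. y - v \<in> ?C}"
        by (rule hull_minimal) (use ext shift in auto)
      ultimately show ?thesis by simp
    qed
    \<comment> \<open>The segment from \<open>v\<close> to \<open>w\<close> crosses level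
      \<open>h\<close> at parameter \<open>t\<close>; the crossing point lies in the slice
      \<open>?Q\<close>, and rescaling by \<open>1/t\<close> leads back to \<open>w\<close>.\<close>
    define t where "t = (b - h) / (b - a \<bullet> w)"
    have t: "0 < t" "t < 1" "t * (b - a \<bullet> w) = b - h"
      using hb wh[OF w False] by (auto simp: t_def)
    let ?q = "v + t *\<^sub>R (w - v)"
    have "?q = (1 - t) *\<^sub>R v + t *\<^sub>R w" by (simp add: algebra_simps)
    then have "?q \<in> P" using polytope_imp_convex[OF P] vP w sub t
      by (metis convex_alt less_imp_le subsetD)
    moreover have "a \<bullet> ?q = h" using t(3) avb by (simp add: inner_simps algebra_simps)
    ultimately have "?q - v \<in> ?C" using Qsub by blast
    then show ?thesis using convex_cone_hull_scaled_diff t(1) by blast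
  qed
  have "convex hull (vertices_of P) \<subseteq> {y. y - v \<in> ?C}"
    by (rule hull_minimal) (use vert shift in auto)
  then show ?thesis using polytope_eq_hull[OF P] x by blast
qed

section \<open>Two-faces of simple polytopes\<close>

lemma neighbours_subset_polytope: "neighbours P v \<subseteq> P"
  using neighbours_subset by (fastforce simp: vertices_of_def extreme_point_of_def)

lemma neighbours_sym: "u \<in> neighbours P v \<longleftrightarrow> v \<in> neighbours P u"
  by (simp add: neighbours_def closed_segment_commute)

lemma neighbours_mem_vertices: "u \<in> neighbours P v \<Longrightarrow> u \<in> vertices_of P \<and> v \<in> vertices_of P \<and> u \<noteq> v"
  using neighbours_subset neighbours_sym by blast

lemma vertices_of_face:
  "F face_of P \<Longrightarrow> vertices_of F = vertices_of P \<inter> F"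
  using extreme_point_of_face by (auto simp: vertices_of_def)

lemma span_neighbour_directions:
  fixes P :: "'a::euclidean_space set"
  assumes "polytope P" "v \<in> vertices_of P"
  shows "span ((\<lambda>u. u - v) ` neighbours P v) = span ((\<lambda>x. x - v) ` P)"
proof
  show "span ((\<lambda>u. u - v) ` neighbours P v) \<subseteq> span ((\<lambda>x. x - v) ` P)"
    using neighbours_subset_polytope by (intro span_mono image_mono) auto
  have "convex_cone hull ((\<lambda>u. u - v) ` neighbours P v) \<subseteq> span ((\<lambda>u. u - v) ` neighbours P v)"
    by (rule hull_minimal) (simp_all add: span_superset convex_cone_span)
  then have "(\<lambda>x. x - v) ` P \<subseteq> span ((\<lambda>u. u - v) ` neighbours P v)"
    using polytope_subset_vertex_cone[OF assms] by blast
  then show "span ((\<lambda>x. x - v) ` P) \<subseteq> span ((\<lambda>u. u - v) ` neighbours P v)"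
    by (simp add: span_minimal)
qed

lemma dim_neighbour_directions:
  fixes P :: "'a::euclidean_space set"
  assumes "polytope P" "v \<in> vertices_of P"
  shows "int (dim ((\<lambda>u. u - v) ` neighbours P v)) = aff_dim P"
proof -
  have "v \<in> affine hull P"
    using assms by (auto simp: vertices_of_def extreme_point_of_def intro: hull_inc)
  then show ?thesis
    using span_neighbour_directions[OF assms] by (metis aff_dim_eq_dim_subtract dim_span)
qed

lemma card_neighbours_eq_edges:
  fixes P :: "'a::euclidean_space set"
  assumes "polytope P" "v \<in> vertices_of P"
  shows "card (neighbours P v) = card {e. e edge_of P \<and> v \<in> e}"
proof (rule bij_betw_same_card)
  show "bij_betw (closed_segment v) (neighbours P v) {e. e edge_of P \<and> v \<in> e}"
    unfolding bij_betw_def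
  proof
    show "inj_on (closed_segment v) (neighbours P v)"
      by (auto simp: inj_on_def doubleton_eq_iff)
    show "closed_segment v ` neighbours P v = {e. e edge_of P \<and> v \<in> e}"
    proof (intro equalityI subsetI)
      fix e assume "e \<in> {e. e edge_of P \<and> v \<in> e}"
      then obtain u where "e = closed_segment v u" "e edge_of P"
        using edge_of_polytope_segment assms by (metis mem_Collect_eq vertices_of_def)
      then show "e \<in> closed_segment v ` neighbours P v" by (auto simp: neighbours_def)
    qed (auto simp: neighbours_def)
  qed
qed

lemma simple_polytope_card_neighbours:
  assumes "simple_polytope d P" "v \<in> vertices_of P"
  shows "card (neighbours P v) = d"
  using assms card_neighbours_eq_edges[of P v] by (auto simp: simple_polytope_def)

text \<open>There are exactly \<open>d\<close> edge directions at \<open>v\<close>, and by the cone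
  lemma they span a space of dimension \<open>d\<close>.\<close>

lemma simple_polytope_independent:
  fixes P :: "'a::euclidean_space set"
  assumes "simple_polytope d P" "v \<in> vertices_of P"
  shows "independent ((\<lambda>u. u - v) ` neighbours P v)"
proof -
  let ?D = "(\<lambda>u. u - v) ` neighbours P v"
  have P: "polytope P" "aff_dim P = int d" using assms by (auto simp: simple_polytope_def)
  have "card ?D = d"
    using simple_polytope_card_neighbours[OF assms] by (simp add: card_image)
  then have "card ?D = dim ?D" using dim_neighbour_directions[OF P(1) assms(2)] P(2) by simp
  then show ?thesis
    using card_eq_dim[OF order_refl, of ?D] finite_imageI[OF finite_neighbours[OF P(1)], of "\<lambda>u. u - v" v]
      span_superset[of ?D] by simp
qed

text \<open>Faces of a simple polytope are again simple: the edge directions of \<open>F\<close> at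
  \<open>v\<close> span the direction space of \<open>F\<close>, and they are independent as part of
  the independent family at \<open>v\<close> in \<open>P\<close>.\<close>

lemma simple_polytope_face_card_neighbours:
  fixes P :: "'a::euclidean_space set"
  assumes "simple_polytope d P" "F face_of P" "v \<in> vertices_of F"
  shows "int (card (neighbours F v)) = aff_dim F"
proof -
  let ?D = "(\<lambda>u. u - v) ` neighbours F v"
  have v: "v \<in> vertices_of P" "v \<in> F" using assms vertices_of_face by blast+
  have "?D \<subseteq> (\<lambda>u. u - v) ` neighbours P v"
    using neighbours_face[OF assms(2) v(2)] by auto
  then have "independent ?D"
    using simple_polytope_independent[OF assms(1) v(1)] independent_mono by blast
  then have "dim ?D = card ?D" by (rule dim_eq_card_independent)
  also have "card ?D = card (neighbours F v)" by (simp add: card_image)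
  moreover have "polytope F"
    using assms face_of_polytope_polytope by (auto simp: simple_polytope_def)
  ultimately show ?thesis using dim_neighbour_directions[OF _ assms(3)] by simp
qed

text \<open>By independence some linear functional is 0 on the directions to \<open>M\<close> and -1
  on the other edge directions at \<open>v\<close>. The cone lemma makes \<open>v\<close> a maximum
  of it on \<open>P\<close>, so the face it exposes keeps exactly the neighbours in
  \<open>M\<close>.\<close>

lemma simple_polytope_face_spanned:
  fixes P :: "'a::euclidean_space set"
  assumes "simple_polytope d P" "v \<in> vertices_of P" "M \<subseteq> neighbours P v"
  obtains F where "F face_of P" "v \<in> F" "neighbours F v = M"
proof -
  let ?D = "(\<lambda>u. u - v) ` neighbours P v"
  have P: "polytope P" using assms by (simp add: simple_polytope_def)
  obtain g :: "'a \<Rightarrow> real" where g: "linear g"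
      "\<And>y. y \<in> ?D \<Longrightarrow> g y = (if y + v \<in> M then 0 else -1)"
    using linear_independent_extend[OF simple_polytope_independent[OF assms(1,2)],
        of "\<lambda>y. if y + v \<in> M then 0 else -1"] by blast
  \<comment> \<open>This is the vector representing the functional \<open>g\<close> as an inner
    product.\<close>
  define c where "c = adjoint g 1"
  have c: "c \<bullet> y = g y" for y
    using adjoint_works[OF g(1), of y 1] by (simp add: c_def inner_commute)
  have cN: "c \<bullet> (u - v) = (if u \<in> M then 0 else -1)" if "u \<in> neighbours P v" for u
    using g(2)[of "u - v"] that c by simp
  have "convex_cone hull ?D \<subseteq> {y. c \<bullet> y \<le> 0}"
    by (rule hull_minimal) (use cN in \<open>auto simp: convex_cone_halfspace_le\<close>)
  then have le: "c \<bullet> x \<le> c \<bullet> v" if "x \<in> P" for x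
    using polytope_subset_vertex_cone[OF P assms(2) that] by (auto simp: inner_diff_right)
  let ?F = "P \<inter> {x. c \<bullet> x = c \<bullet> v}"
  have F: "?F face_of P"
    by (rule face_of_Int_supporting_hyperplane_le) (use P polytope_imp_convex le in auto)
  have v: "v \<in> ?F" using assms(2) by (auto simp: vertices_of_def extreme_point_of_def)
  have "neighbours P v \<inter> ?F = M"
  proof -
    have "u \<in> ?F \<longleftrightarrow> u \<in> M" if "u \<in> neighbours P v" for u
      using cN[OF that] that neighbours_subset_polytope[of P v]
      by (auto simp: inner_diff_right split: if_splits)
    then show ?thesis using assms(3) by blast
  qed
  then show thesis using that F v neighbours_face[OF F v] by blast
qed

lemma two_face_exists:
  fixes P :: "'a::euclidean_space set"
  assumes "simple_polytope d P" "u \<in> neighbours P v" "w \<in> neighbours P v" "u \<noteq> w"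
  obtains F where "F face_of P" "aff_dim F = 2" "{v, u, w} \<subseteq> F"
proof -
  have v: "v \<in> vertices_of P" using assms neighbours_mem_vertices by blast
  obtain F where F: "F face_of P" "v \<in> F" "neighbours F v = {u, w}"
    using simple_polytope_face_spanned[OF assms(1) v, of "{u,w}"] assms by blast
  moreover have "v \<in> vertices_of F" using F v vertices_of_face by blast
  ultimately have "aff_dim F = 2"
    using simple_polytope_face_card_neighbours[OF assms(1)] assms(4) by fastforce
  then show thesis using that F neighbours_subset_polytope[of F v] by blast
qed

text \<open>The face \<open>F \<inter> G\<close> has at least the two neighbours \<open>u\<close>
  and \<open>w\<close> at \<open>v\<close>, so its dimension is at least 2, which no proper face of
  \<open>F\<close> attains. This serves twice: for uniqueness of the 2-face spanned by a frame, and
  to place that 2-face inside a larger face.\<close>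

lemma two_face_subset:
  fixes P :: "'a::euclidean_space set"
  assumes P: "simple_polytope d P" and u: "u \<in> neighbours P v" and w: "w \<in> neighbours P v" "u \<noteq> w"
    and F: "F face_of P" "aff_dim F = 2" "{v, u, w} \<subseteq> F"
    and G: "G face_of P" "{v, u, w} \<subseteq> G"
  shows "F \<subseteq> G"
proof -
  have v: "v \<in> vertices_of P" using assms neighbours_mem_vertices by blast
  have FG: "F \<inter> G face_of P" using F G face_of_Int by blast
  have "v \<in> vertices_of (F \<inter> G)" "{u, w} \<subseteq> neighbours (F \<inter> G) v"
    using vertices_of_face[OF FG] neighbours_face[OF FG] v u w F G by auto
  moreover have "finite (neighbours (F \<inter> G) v)"
    using FG P face_of_polytope_polytope finite_neighbours by (auto simp: simple_polytope_def)
  ultimately have "card {u, w} \<le> card (neighbours (F \<inter> G) v)" using card_mono by blast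
  then have "aff_dim (F \<inter> G) \<ge> 2"
    using simple_polytope_face_card_neighbours[OF P FG \<open>v \<in> vertices_of (F \<inter> G)\<close>] w(2) by simp
  moreover have "F \<inter> G face_of F" using FG F by (meson face_of_face inf_le1)
  ultimately have "F \<inter> G = F"
    using face_of_aff_dim_lt[of F "F \<inter> G"] F face_of_imp_convex by fastforce
  then show ?thesis by blast
qed

section \<open>The graph of a polytope and its 2-systems\<close>

lemma polytope_graph_simps [simp]:
  "nodes (polytope_graph P) = vertices_of P"
  "{u, v} \<in> edges (polytope_graph P) \<longleftrightarrow> u \<in> neighbours P v"
  by (auto simp: nodes_def edges_def polytope_graph_def neighbours_def doubleton_eq_iff closed_segment_commute)

lemma edges_polytope_graph_cases:
  assumes "e \<in> edges (polytope_graph P)" "v \<in> e"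
  obtains u where "e = {u, v}" "u \<in> neighbours P v"
proof -
  obtain a b where "e = {a, b}" using assms(1) by (auto simp: edges_def polytope_graph_def)
  then obtain u where "e = {u, v}" using assms(2) by blast
  then show thesis using that assms(1) by simp
qed

lemma regular_induced_iff:
  assumes "S \<subseteq> vertices_of P"
  shows "regular_graph k (induced_subgraph (polytope_graph P) S) \<longleftrightarrow>
    (\<forall>v\<in>S. card (neighbours P v \<inter> S) = k)"
proof -
  let ?E = "\<lambda>v. {e \<in> edges (induced_subgraph (polytope_graph P) S). v \<in> e}"
  have "card (?E v) = card (neighbours P v \<inter> S)" if "v \<in> S" for v
  proof -
    have "?E v = (\<lambda>u. {u, v}) ` (neighbours P v \<inter> S)"
    proof (intro equalityI subsetI)
      fix e assume e: "e \<in> ?E v"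
      then have "e \<in> edges (polytope_graph P)" "v \<in> e" "e \<subseteq> S"
        by (auto simp: induced_subgraph_def edges_def)
      moreover then obtain u where "e = {u, v}" "u \<in> neighbours P v"
        using edges_polytope_graph_cases by metis
      ultimately show "e \<in> (\<lambda>u. {u, v}) ` (neighbours P v \<inter> S)" by auto
    next
      fix e assume "e \<in> (\<lambda>u. {u, v}) ` (neighbours P v \<inter> S)"
      then obtain u where "e = {u, v}" "u \<in> neighbours P v" "u \<in> S" by auto
      moreover then have "e \<in> edges (polytope_graph P)" by simp
      ultimately show "e \<in> ?E v" using that by (auto simp: induced_subgraph_def edges_def)
    qed
    moreover have "inj_on (\<lambda>u. {u, v}) (neighbours P v \<inter> S)"
      by (auto simp: inj_on_def doubleton_eq_iff)
    ultimately show ?thesis by (simp add: card_image)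
  qed
  moreover have "nodes (induced_subgraph (polytope_graph P) S) = S"
    using assms by (auto simp: induced_subgraph_def nodes_def polytope_graph_def)
  ultimately show ?thesis by (simp add: regular_graph_def)
qed

lemma is_sink_induced_iff:
  assumes "S \<subseteq> vertices_of P"
  shows "is_sink (induced_subgraph (polytope_graph P) S) \<O> v \<longleftrightarrow>
    v \<in> S \<and> (\<forall>u \<in> neighbours P v \<inter> S. (u, v) \<in> \<O>)"
proof -
  have "nodes (induced_subgraph (polytope_graph P) S) = S"
    using assms by (auto simp: induced_subgraph_def nodes_def polytope_graph_def)
  moreover have "{u, v} \<in> edges (induced_subgraph (polytope_graph P) S) \<longleftrightarrow>
      u \<in> neighbours P v \<and> u \<in> S \<and> v \<in> S" for u
    using polytope_graph_simps(2)[of u v P] by (auto simp: induced_subgraph_def edges_def)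
  ultimately show ?thesis by (auto simp: is_sink_def)
qed

section \<open>2-frames and 2-systems in terms of neighbours\<close>

lemma star_graph_two: "star_graph 2 = ({0, 1, 2}, {{0, 1}, {0, 2}})"
proof -
  have "{1..2::nat} = {1, 2}" "{0..2::nat} = {0, 1, 2}" by auto
  then show ?thesis by (auto simp: star_graph_def)
qed

lemma two_frame_nodes_iff:
  "(\<exists>H. two_frame P H \<and> nodes H = X) \<longleftrightarrow>
    (\<exists>v u w. X = {v, u, w} \<and> u \<in> neighbours P v \<and> w \<in> neighbours P v \<and> u \<noteq> w)"
proof
  assume "\<exists>H. two_frame P H \<and> nodes H = X"
  then obtain H f where H: "subgraph H (polytope_graph P)" "nodes H = X"
    "bij_betw f {0, 1, 2::nat} (nodes H)" "edges H = (\<lambda>e. f ` e) ` {{0, 1}, {0, 2}}"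
    by (auto simp: two_frame_def isomorphic_graphs_def star_graph_two nodes_def edges_def)
  have X: "X = {f 0, f 1, f 2}" using H(2,3) by (auto simp: bij_betw_def)
  have "f 1 \<noteq> f 2" using H(3) by (auto simp: bij_betw_def inj_on_def)
  moreover have "{f 1, f 0} \<in> edges (polytope_graph P)" "{f 2, f 0} \<in> edges (polytope_graph P)"
    using H(1,4) by (auto simp: subgraph_def insert_commute)
  ultimately show "\<exists>v u w. X = {v, u, w} \<and> u \<in> neighbours P v \<and> w \<in> neighbours P v \<and> u \<noteq> w"
    using X polytope_graph_simps(2) by metis
next
  assume "\<exists>v u w. X = {v, u, w} \<and> u \<in> neighbours P v \<and> w \<in> neighbours P v \<and> u \<noteq> w"
  then obtain v u w where X: "X = {v, u, w}" "u \<in> neighbours P v" "w \<in> neighbours P v" "u \<noteq> w"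
    by blast
  note mem = neighbours_mem_vertices[OF X(2)] neighbours_mem_vertices[OF X(3)]
  let ?H = "({v, u, w}, {{u, v}, {w, v}})"
  \<comment> \<open>The default value \<open>v\<close> is the image of the centre 0 of the
    star.\<close>
  let ?f = "(\<lambda>_. v)(1 := u, 2 := w) :: nat \<Rightarrow> 'a"
  have "bij_betw ?f {0, 1, 2} {v, u, w}"
    using X(4) mem by (auto simp: bij_betw_def inj_on_def)
  moreover have "{{u, v}, {w, v}} = (\<lambda>e. ?f ` e) ` {{0, 1}, {0, 2}}" by auto
  ultimately have "isomorphic_graphs (star_graph 2) ?H"
    unfolding isomorphic_graphs_def star_graph_two nodes_def edges_def by auto
  moreover have "subgraph ?H (polytope_graph P)"
  proof -
    have "{u, v} \<in> edges (polytope_graph P)" "{w, v} \<in> edges (polytope_graph P)" using X by simp_all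
    moreover have "nodes ?H = {v, u, w}" "edges ?H = {{u, v}, {w, v}}" by (simp_all add: nodes_def edges_def)
    ultimately show ?thesis unfolding subgraph_def using mem by simp
  qed
  ultimately have "two_frame P ?H \<and> nodes ?H = X" using X(1) by (simp add: two_frame_def nodes_def)
  then show "\<exists>H. two_frame P H \<and> nodes H = X" by blast
qed

text \<open>A 2-system constrains frames only through their node sets, so subgraphs and isomorphisms
  can be replaced by a vertex with two distinct neighbours. All later arguments use this
  form.\<close>

lemma two_system_iff:
  "two_system P \<S> \<longleftrightarrow>
    (\<forall>S\<in>\<S>. S \<noteq> {} \<and> S \<subseteq> vertices_of P \<and> (\<forall>v\<in>S. card (neighbours P v \<inter> S) = 2)) \<and>
    (\<forall>v u w. u \<in> neighbours P v \<longrightarrow> w \<in> neighbours P v \<longrightarrow> u \<noteq> w \<longrightarrow>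
       (\<exists>!S. S \<in> \<S> \<and> {v, u, w} \<subseteq> S))"
proof -
  have frames: "(\<forall>H. two_frame P H \<longrightarrow> Q (nodes H)) \<longleftrightarrow>
    (\<forall>v u w. u \<in> neighbours P v \<longrightarrow> w \<in> neighbours P v \<longrightarrow> u \<noteq> w \<longrightarrow> Q {v, u, w})" for Q
  proof -
    have "(\<forall>H. two_frame P H \<longrightarrow> Q (nodes H)) \<longleftrightarrow>
      (\<forall>X. (\<exists>H. two_frame P H \<and> nodes H = X) \<longrightarrow> Q X)" by blast
    also have "\<dots> \<longleftrightarrow>
      (\<forall>v u w. u \<in> neighbours P v \<longrightarrow> w \<in> neighbours P v \<longrightarrow> u \<noteq> w \<longrightarrow> Q {v, u, w})"
      unfolding two_frame_nodes_iff by blast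
    finally show ?thesis .
  qed
  show ?thesis
    unfolding two_system_def frames[of "\<lambda>X. \<exists>!S. S \<in> \<S> \<and> X \<subseteq> S"]
    by (simp only: regular_induced_iff cong: conj_cong)
qed

definition two_face_system :: "'a::euclidean_space set \<Rightarrow> 'a set set" where
  "two_face_system P = vertices_of ` {F. F face_of P \<and> aff_dim F = 2}"

text \<open>A 2-face has degree 2 at each of its vertices because degree equals dimension in faces
  of a simple polytope. Two 2-faces containing the same frame include each other by
  \<open>two_face_subset\<close>.\<close>

lemma two_system_two_faces:
  fixes P :: "'a::euclidean_space set"
  assumes "simple_polytope d P"
  shows "two_system P (two_face_system P)"
  unfolding two_system_iff
proof (intro conjI ballI allI impI)
  have P: "polytope P" using assms by (simp add: simple_polytope_def)
  fix S assume "S \<in> two_face_system P"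
  then obtain F where F: "F face_of P" "aff_dim F = 2" "S = vertices_of F"
    by (auto simp: two_face_system_def)
  have "polytope F" using F P face_of_polytope_polytope by blast
  then show "S \<noteq> {}" using polytope_eq_hull[of F] F(2,3)
    by (metis aff_dim_empty convex_hull_empty neg_numeral_neq_numeral numeral_One)
  show "S \<subseteq> vertices_of P" using F vertices_of_face by blast
  fix v assume v: "v \<in> S"
  have "neighbours P v \<inter> S = neighbours F v"
    using neighbours_face[OF F(1)] vertices_of_face[OF F(1)] v F(3) neighbours_subset by blast
  then show "card (neighbours P v \<inter> S) = 2"
    using simple_polytope_face_card_neighbours[OF assms F(1)] v F by fastforce
next
  fix v u w assume uw: "u \<in> neighbours P v" "w \<in> neighbours P v" "u \<noteq> w"
  obtain F where F: "F face_of P" "aff_dim F = 2" "{v, u, w} \<subseteq> F"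
    using two_face_exists[OF assms uw] .
  show "\<exists>!S. S \<in> two_face_system P \<and> {v, u, w} \<subseteq> S"
  proof (intro ex1I conjI)
    show "vertices_of F \<in> two_face_system P" using F by (auto simp: two_face_system_def)
    show "{v, u, w} \<subseteq> vertices_of F"
      using F vertices_of_face[OF F(1)] uw neighbours_mem_vertices by blast
    fix S assume S: "S \<in> two_face_system P \<and> {v, u, w} \<subseteq> S"
    then obtain G where G: "G face_of P" "aff_dim G = 2" "S = vertices_of G"
      by (auto simp: two_face_system_def)
    then have "{v, u, w} \<subseteq> G" using S vertices_of_face[OF G(1)] by blast
    then have "F = G" using two_face_subset[OF assms uw] F G by blast
    then show "S = vertices_of F" using G by simp
  qed
qed

section \<open>Sinks of acyclic orientations\<close>

lemma acyclic_orientation_arc: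
  assumes "acyclic_orientation (polytope_graph P) \<O>"
  shows "(u, v) \<in> \<O> \<Longrightarrow> u \<in> neighbours P v"
    and "u \<in> neighbours P v \<Longrightarrow> (u, v) \<in> \<O> \<longleftrightarrow> (v, u) \<notin> \<O>"
  using assms unfolding acyclic_orientation_def orientation_def by auto

text \<open>The converse is taken so that minimal elements are sinks and induction passes from the
  heads of arcs to their tails.\<close>

lemma wf_acyclic_orientation:
  assumes "polytope P" "acyclic_orientation (polytope_graph P) \<O>"
  shows "wf (\<O>\<inverse>)"
proof (rule finite_acyclic_wf_converse)
  have "\<O> \<subseteq> vertices_of P \<times> vertices_of P"
    using acyclic_orientation_arc(1)[OF assms(2)] neighbours_mem_vertices by fast
  then show "finite \<O>" using finite_vertices[OF assms(1)] finite_subset by blast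
  show "acyclic \<O>" using assms(2) by (simp add: acyclic_orientation_def)
qed

lemma orientation_reaches_sink:
  assumes P: "polytope P" and O: "acyclic_orientation (polytope_graph P) \<O>"
    and W: "W \<subseteq> vertices_of P" "x \<in> W"
  obtains t where "is_sink (induced_subgraph (polytope_graph P) W) \<O> t" "(x, t) \<in> (\<O> \<inter> W \<times> W)\<^sup>*"
proof -
  let ?R = "{y \<in> W. (x, y) \<in> (\<O> \<inter> W \<times> W)\<^sup>*}"
  have "x \<in> ?R" using W by simp
  with wf_acyclic_orientation[OF P O]
  obtain t where t: "t \<in> ?R" "\<And>y. (y, t) \<in> \<O>\<inverse> \<Longrightarrow> y \<notin> ?R"
    by (rule wfE_min) blast
  have "(u, t) \<in> \<O>" if "u \<in> neighbours P t" "u \<in> W" for u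
  proof (rule ccontr)
    assume "(u, t) \<notin> \<O>"
    then have "(t, u) \<in> \<O>" using acyclic_orientation_arc(2)[OF O that(1)] by blast
    then have "(t, u) \<in> \<O> \<inter> W \<times> W" using t that by blast
    then have "u \<in> ?R" using t(1) that by (auto intro: rtrancl_into_rtrancl)
    then show False using t(2)[of u] \<open>(t, u) \<in> \<O>\<close> by blast
  qed
  then have "is_sink (induced_subgraph (polytope_graph P) W) \<O> t"
    using is_sink_induced_iff[OF W(1)] t(1) by blast
  then show thesis using that t(1) by blast
qed

text \<open>A frame is encoded as its centre with the pair of its leaves. Keeping the centre apart
  distinguishes the three frames of a triangle, which share their node set.\<close>

definition sink_frames :: "'a::euclidean_space set \<Rightarrow> ('a \<times> 'a) set \<Rightarrow> ('a \<times> 'a set) set" where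
  "sink_frames P \<O> = (SIGMA v:vertices_of P. {A. A \<subseteq> {u. (u, v) \<in> \<O>} \<and> card A = 2})"

lemma finite_in_neighbours:
  assumes "polytope P" "acyclic_orientation (polytope_graph P) \<O>"
  shows "finite {u. (u, v) \<in> \<O>}"
  using acyclic_orientation_arc(1)[OF assms(2)] finite_neighbours[OF assms(1)]
  by (metis finite_subset mem_Collect_eq subsetI)

lemma finite_sink_frames:
  assumes "polytope P" "acyclic_orientation (polytope_graph P) \<O>"
  shows "finite (sink_frames P \<O>)"
  unfolding sink_frames_def
  using finite_vertices[OF assms(1)] finite_in_neighbours[OF assms]
  by (intro finite_SigmaI) auto

text \<open>A vertex of indegree \<open>i\<close> is the centre of \<open>i choose 2\<close> such
  frames. Grouping the vertices by indegree gives the sum; simplicity bounds indegrees by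
  \<open>d\<close>, so the range of summation reaches every vertex.\<close>

lemma H2_eq_card_sink_frames:
  fixes P :: "'a::euclidean_space set"
  assumes P: "simple_polytope d P" and O: "acyclic_orientation (polytope_graph P) \<O>"
  shows "H2 d P \<O> = card (sink_frames P \<O>)"
proof -
  let ?i = "\<lambda>v. card {u. (u, v) \<in> \<O>}"
  have pP: "polytope P" using P by (simp add: simple_polytope_def)
  note fin = finite_in_neighbours[OF pP O]
  have deg: "?i v \<le> d" if "v \<in> vertices_of P" for v
  proof -
    have "{u. (u, v) \<in> \<O>} \<subseteq> neighbours P v"
      using acyclic_orientation_arc(1)[OF O] by blast
    then show ?thesis
      using card_mono finite_neighbours[OF pP] simple_polytope_card_neighbours[OF P that] by metis
  qed
  have "H2 d P \<O> = (\<Sum>i = 0..d. \<Sum>v \<in> {v \<in> vertices_of P. ?i v = i}. ?i v choose 2)"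
    unfolding H2_def h_number_def polytope_graph_simps
    by (intro sum.cong refl) simp
  also have "\<dots> = (\<Sum>v\<in>vertices_of P. ?i v choose 2)"
    by (rule sum.group) (use finite_vertices[OF pP] deg in auto)
  also have "\<dots> = (\<Sum>v\<in>vertices_of P. card {A. A \<subseteq> {u. (u, v) \<in> \<O>} \<and> card A = 2})"
    by (simp add: n_subsets[OF fin])
  also have "\<dots> = card (sink_frames P \<O>)"
    unfolding sink_frames_def using finite_vertices[OF pP] fin by (intro card_SigmaI[symmetric]) auto
  finally show ?thesis .
qed

text \<open>Send each sink frame to the unique member of \<open>\<S>\<close> containing it. This map
  is onto, since every member has a sink, and its fibre over \<open>S\<close> corresponds to the
  sinks of \<open>S\<close>, since a sink of a 2-regular graph determines its frame. So it is
  injective exactly when all sinks are unique.\<close>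

lemma two_system_H2:
  fixes P :: "'a::euclidean_space set"
  assumes P: "simple_polytope d P" and O: "acyclic_orientation (polytope_graph P) \<O>"
    and S: "two_system P \<S>"
  shows "card \<S> \<le> H2 d P \<O>"
    and "card \<S> = H2 d P \<O> \<longleftrightarrow>
      (\<forall>S\<in>\<S>. \<exists>!v. is_sink (induced_subgraph (polytope_graph P) S) \<O> v)"
proof -
  let ?T = "sink_frames P \<O>"
  let ?sink = "\<lambda>S. is_sink (induced_subgraph (polytope_graph P) S) \<O>"
  have pP: "polytope P" using P by (simp add: simple_polytope_def)
  note fin = finite_sink_frames[OF pP O]
  note S' = S[unfolded two_system_iff]
  have frame: "\<exists>!S. S \<in> \<S> \<and> insert v A \<subseteq> S" if "(v, A) \<in> ?T" for v A
  proof -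
    have A: "A \<subseteq> {u. (u, v) \<in> \<O>}" "card A = 2" using that by (auto simp: sink_frames_def)
    then obtain u w where uw: "A = {u, w}" "u \<noteq> w" by (meson card_2_iff)
    then have "u \<in> neighbours P v" "w \<in> neighbours P v"
      using A(1) acyclic_orientation_arc(1)[OF O] by auto
    then show ?thesis using S' uw by simp
  qed
  define g where "g = (\<lambda>(v, A). THE S. S \<in> \<S> \<and> insert v A \<subseteq> S)"
  have g: "g (v, A) \<in> \<S>" "insert v A \<subseteq> g (v, A)" if "(v, A) \<in> ?T" for v A
    using theI'[OF frame[OF that]] by (auto simp: g_def)
  have g_eq: "g (v, A) = S" if "(v, A) \<in> ?T" "S \<in> \<S>" "insert v A \<subseteq> S" for v A S
    using frame[OF that(1)] g[OF that(1)] that by blast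
  have sub: "S \<subseteq> vertices_of P" if "S \<in> \<S>" for S using S' that by blast
  have deg2: "card (neighbours P v \<inter> S) = 2" if "S \<in> \<S>" "v \<in> S" for S v using S' that by simp
  have sink_frame: "(v, neighbours P v \<inter> S) \<in> ?T" "g (v, neighbours P v \<inter> S) = S"
    if "S \<in> \<S>" "?sink S v" for S v
  proof -
    have v: "v \<in> S" "\<forall>u \<in> neighbours P v \<inter> S. (u, v) \<in> \<O>"
      using that is_sink_induced_iff[OF sub] by auto
    moreover have "card (neighbours P v \<inter> S) = 2" using deg2 that(1) v(1) .
    ultimately show "(v, neighbours P v \<inter> S) \<in> ?T"
      using sub[OF that(1)] by (auto simp: sink_frames_def)
    then show "g (v, neighbours P v \<inter> S) = S" using g_eq that v by blast
  qed
  \<comment> \<open>Both leaves lie among the only two neighbours of \<open>v\<close> in the member,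
    hence are all of them, and so \<open>v\<close> is a sink there.\<close>
  have frame_sink: "?sink (g (v, A)) v" "A = neighbours P v \<inter> g (v, A)" if "(v, A) \<in> ?T" for v A
  proof -
    let ?S = "g (v, A)"
    have A: "A \<subseteq> {u. (u, v) \<in> \<O>}" "card A = 2" using that by (auto simp: sink_frames_def)
    have "A \<subseteq> neighbours P v" using A(1) acyclic_orientation_arc(1)[OF O] by auto
    moreover have "insert v A \<subseteq> ?S" by (rule g(2)[OF that])
    moreover have "card (neighbours P v \<inter> ?S) = 2"
      using deg2[OF g(1)[OF that]] g(2)[OF that] by simp
    ultimately show A': "A = neighbours P v \<inter> ?S"
      using A(2) finite_neighbours[OF pP] by (metis card_subset_eq finite_Int le_inf_iff insert_subset)
    have "v \<in> ?S" "\<forall>u \<in> neighbours P v \<inter> ?S. (u, v) \<in> \<O>"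
      using A A' g(2)[OF that] by auto
    then show "?sink ?S v" using is_sink_induced_iff[OF sub[OF g(1)[OF that]]] by blast
  qed
  have ex_sink: "\<exists>v. ?sink S v" if S: "S \<in> \<S>" for S
  proof -
    have "S \<noteq> {}" using S' S by simp
    then obtain x where x: "x \<in> S" by blast
    obtain t where "?sink S t" using orientation_reaches_sink[OF pP O sub[OF S] x] .
    then show ?thesis ..
  qed
  have image: "g ` ?T = \<S>"
  proof
    show "g ` ?T \<subseteq> \<S>" using g by auto
    show "\<S> \<subseteq> g ` ?T"
    proof
      fix S assume S: "S \<in> \<S>"
      obtain v where "?sink S v" using ex_sink[OF S] ..
      then show "S \<in> g ` ?T" using sink_frame[OF S] by (metis image_eqI)
    qed
  qed
  show "card \<S> \<le> H2 d P \<O>"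
    unfolding H2_eq_card_sink_frames[OF P O] using image card_image_le[OF fin] by metis
  have "card \<S> = card ?T \<longleftrightarrow> inj_on g ?T"
    using image inj_on_iff_eq_card[OF fin, of g] by simp
  also have "\<dots> \<longleftrightarrow> (\<forall>S\<in>\<S>. \<exists>!v. ?sink S v)"
  proof
    assume inj: "inj_on g ?T"
    show "\<forall>S\<in>\<S>. \<exists>!v. ?sink S v"
    proof
      fix S assume S: "S \<in> \<S>"
      have "v = w" if v: "?sink S v" and w: "?sink S w" for v w
      proof -
        have "(v, neighbours P v \<inter> S) = (w, neighbours P w \<inter> S)"
          using inj_onD[OF inj _ sink_frame(1)[OF S v] sink_frame(1)[OF S w]]
            sink_frame(2)[OF S v] sink_frame(2)[OF S w] by simp
        then show ?thesis by simp
      qed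
      then show "\<exists>!v. ?sink S v" using ex_sink[OF S] by blast
    qed
  next
    assume uniq: "\<forall>S\<in>\<S>. \<exists>!v. ?sink S v"
    show "inj_on g ?T"
    proof (rule inj_onI)
      fix p q assume pq: "p \<in> ?T" "q \<in> ?T" "g p = g q"
      obtain v A w B where [simp]: "p = (v, A)" "q = (w, B)" by (metis surj_pair)
      have vA: "(v, A) \<in> ?T" and wB: "(w, B) \<in> ?T" and eq: "g (v, A) = g (w, B)"
        using pq by simp_all
      have "\<exists>!x. ?sink (g (w, B)) x" using uniq g(1)[OF wB] by blast
      then have "v = w" using frame_sink(1)[OF vA] frame_sink(1)[OF wB] eq by auto
      then show "p = q" using frame_sink(2)[OF vA] frame_sink(2)[OF wB] eq by simp
    qed
  qed
  finally show "card \<S> = H2 d P \<O> \<longleftrightarrow> (\<forall>S\<in>\<S>. \<exists>!v. ?sink S v)"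
    unfolding H2_eq_card_sink_frames[OF P O] .
qed

section \<open>Orientations induced by linear functionals\<close>

text \<open>Finitely many hyperplanes through the origin do not cover the space: a vector good for
  \<open>X\<close> is moved slightly off in the direction of the new \<open>x\<close>.\<close>

lemma ex_inner_nonzero:
  fixes X :: "'a::real_inner set"
  assumes "finite X" "0 \<notin> X"
  obtains c where "\<And>x. x \<in> X \<Longrightarrow> c \<bullet> x \<noteq> 0"
proof -
  have "\<exists>c. \<forall>x\<in>X. c \<bullet> x \<noteq> 0" using assms
  proof (induction X rule: finite_induct)
    case (insert x X)
    then obtain c where c: "\<forall>y\<in>X. c \<bullet> y \<noteq> 0" by blast
    \<comment> \<open>Each \<open>y\<close> not orthogonal to \<open>x\<close> excludes one value of
      \<epsilon>. A \<open>y\<close> orthogonal to \<open>x\<close> differs from \<open>x\<close>,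
      and its product with \<open>c\<close> is unchanged by the move.\<close>
    have "finite ((\<lambda>y. - (c \<bullet> y) / (x \<bullet> y)) ` insert x X)" using insert by blast
    then obtain \<epsilon> where \<epsilon>: "\<epsilon> \<notin> insert 0 ((\<lambda>y. - (c \<bullet> y) / (x \<bullet> y)) ` insert x X)"
      using ex_new_if_finite[OF infinite_UNIV_char_0] by (metis finite_insert)
    have "(c + \<epsilon> *\<^sub>R x) \<bullet> y \<noteq> 0" if y: "y \<in> insert x X" for y
    proof
      assume *: "(c + \<epsilon> *\<^sub>R x) \<bullet> y = 0"
      then have **: "\<epsilon> * (x \<bullet> y) = - (c \<bullet> y)" by (simp add: inner_simps)
      show False
      proof (cases "x \<bullet> y = 0")
        case True
        then have "y \<in> X" using y insert.prems by auto
        then show False using c ** True by simp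
      next
        case False
        then have "\<epsilon> = - (c \<bullet> y) / (x \<bullet> y)" using ** by (simp add: field_simps)
        then show False using \<epsilon> y by blast
      qed
    qed
    then show ?case by blast
  qed simp
  then show thesis using that by blast
qed

lemma ex_inner_inj_on:
  fixes V :: "'a::real_inner set"
  assumes "finite V"
  obtains c where "inj_on ((\<bullet>) c) V"
proof -
  have "finite ((\<lambda>(x, y). x - y) ` (V \<times> V) - {0})" using assms by blast
  then obtain c where c: "\<And>z. z \<in> (\<lambda>(x, y). x - y) ` (V \<times> V) - {0} \<Longrightarrow> c \<bullet> z \<noteq> 0"
    using ex_inner_nonzero[of "(\<lambda>(x, y). x - y) ` (V \<times> V) - {0}"] by blast
  have "inj_on ((\<bullet>) c) V"
  proof (rule inj_onI, rule ccontr)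
    fix x y assume "x \<in> V" "y \<in> V" "c \<bullet> x = c \<bullet> y" "x \<noteq> y"
    then show False using c[of "x - y"] by (auto simp: inner_diff_right)
  qed
  then show thesis using that by blast
qed

text \<open>If no edge at \<open>v\<close> ascends, then no direction in the cone of edge directions
  does, and this cone contains all of \<open>P\<close> seen from \<open>v\<close>.\<close>

lemma local_max_vertex:
  fixes P :: "'a::euclidean_space set"
  assumes "polytope P" "v \<in> vertices_of P" "\<And>u. u \<in> neighbours P v \<Longrightarrow> c \<bullet> u \<le> c \<bullet> v" "x \<in> P"
  shows "c \<bullet> x \<le> c \<bullet> v"
proof -
  have "convex_cone hull ((\<lambda>u. u - v) ` neighbours P v) \<subseteq> {y. c \<bullet> y \<le> 0}"
    by (rule hull_minimal) (use assms(3) in \<open>auto simp: convex_cone_halfspace_le inner_diff_right\<close>)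
  then show ?thesis
    using polytope_subset_vertex_cone[OF assms(1,2,4)] by (auto simp: inner_diff_right)
qed

lemma vertices_of_nonempty:
  fixes P :: "'a::euclidean_space set"
  shows "polytope P \<Longrightarrow> P \<noteq> {} \<Longrightarrow> vertices_of P \<noteq> {}"
  using polytope_eq_hull by (metis convex_hull_empty)

lemma finite_arg_max:
  fixes f :: "'a \<Rightarrow> 'b::linorder"
  assumes "finite S" "S \<noteq> {}"
  obtains m where "m \<in> S" "\<And>x. x \<in> S \<Longrightarrow> f x \<le> f m"
proof -
  have "Max (f ` S) \<in> f ` S" using assms by (intro Max_in) auto
  then obtain m where "m \<in> S" "f m = Max (f ` S)" by force
  then show thesis using that Max_ge[of "f ` S"] assms(1) by simp
qed

definition linear_orientation :: "'a::euclidean_space set \<Rightarrow> 'a \<Rightarrow> ('a \<times> 'a) set" where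
  "linear_orientation P c = {(u, v). u \<in> neighbours P v \<and> c \<bullet> u < c \<bullet> v}"

text \<open>A sink on a face is a vertex with no ascending edge in that face, hence a global maximum
  of \<open>c\<close> there. Finiteness gives a maximal vertex and injectivity of \<open>c\<close>
  on the vertices makes it unique.\<close>

lemma aof_linear_orientation:
  fixes P :: "'a::euclidean_space set"
  assumes P: "polytope P" and inj: "inj_on ((\<bullet>) c) (vertices_of P)"
  shows "aof_orientation P (linear_orientation P c)"
  unfolding aof_orientation_def
proof (intro conjI allI impI)
  let ?O = "linear_orientation P c"
  have ne: "c \<bullet> u \<noteq> c \<bullet> v" if "u \<in> neighbours P v" for u v
    using neighbours_mem_vertices[OF that] inj by (auto simp: inj_on_def)
  have "orientation (polytope_graph P) ?O"
    unfolding orientation_def using ne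
    by (auto simp: linear_orientation_def neighbours_sym not_less order_le_less)
  moreover have "acyclic ?O"
  proof -
    have "c \<bullet> u < c \<bullet> v" if "(u, v) \<in> ?O\<^sup>+" for u v
      using that by (induction rule: trancl_induct) (auto simp: linear_orientation_def)
    then show ?thesis unfolding acyclic_def by blast
  qed
  ultimately show "acyclic_orientation (polytope_graph P) ?O"
    by (simp add: acyclic_orientation_def)
  fix F assume "F face_of P \<and> F \<noteq> {}"
  then have F: "F face_of P" "F \<noteq> {}" by auto
  have pF: "polytope F" using F P face_of_polytope_polytope by blast
  have VF: "vertices_of F = vertices_of P \<inter> F" using vertices_of_face F by blast
  have sink: "is_sink (induced_subgraph (polytope_graph P) (vertices_of F)) ?O v \<longleftrightarrow>
      v \<in> vertices_of F \<and> (\<forall>u \<in> vertices_of F. c \<bullet> u \<le> c \<bullet> v)" (is "?s v \<longleftrightarrow> ?m v") for v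
  proof (cases "v \<in> vertices_of F")
    case v: True
    have N: "neighbours P v \<inter> vertices_of F = neighbours F v"
      using neighbours_face[OF F(1), of v] v VF neighbours_subset[of P v] by blast
    have "?s v \<longleftrightarrow> (\<forall>u \<in> neighbours F v. (u, v) \<in> ?O)"
      using is_sink_induced_iff[of "vertices_of F" P] VF v N by auto
    also have "\<dots> \<longleftrightarrow> (\<forall>u \<in> neighbours F v. c \<bullet> u \<le> c \<bullet> v)"
      using ne N by (force simp: linear_orientation_def)
    also have "\<dots> \<longleftrightarrow> (\<forall>u \<in> vertices_of F. c \<bullet> u \<le> c \<bullet> v)"
      using local_max_vertex[OF pF v, of c] VF neighbours_subset[of F v] by blast
    finally show ?thesis using v by simp
  next
    case False
    then show ?thesis using is_sink_induced_iff[of "vertices_of F" P] VF by auto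
  qed
  have V: "finite (vertices_of F)" "vertices_of F \<noteq> {}"
    using finite_vertices vertices_of_nonempty pF F by auto
  then obtain m where "?m m" using finite_arg_max[OF V, of "(\<bullet>) c"] by metis
  moreover have "x = y" if "?m x" "?m y" for x y
  proof -
    have "c \<bullet> x = c \<bullet> y" using that by (meson antisym)
    then show ?thesis using inj that VF by (auto simp: inj_on_def)
  qed
  ultimately show "\<exists>!v. ?s v" unfolding sink by blast
qed

section \<open>From 2-faces to all faces\<close>

lemma unique_sinks_if_unique_sinks_two_faces:
  fixes P :: "'a::euclidean_space set"
  assumes P: "simple_polytope d P" and O: "acyclic_orientation (polytope_graph P) \<O>"
    and two: "\<And>S. S \<in> two_face_system P \<Longrightarrow>
      \<exists>!v. is_sink (induced_subgraph (polytope_graph P) S) \<O> v"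
  shows "aof_orientation P \<O>"
  unfolding aof_orientation_def
proof (intro conjI allI impI)
  show "acyclic_orientation (polytope_graph P) \<O>" by (rule O)
  have pP: "polytope P" using P by (simp add: simple_polytope_def)
  fix F assume F: "F face_of P \<and> F \<noteq> {}"
  then have pF: "polytope F" using pP face_of_polytope_polytope by blast
  let ?V = "vertices_of F"
  let ?sink = "is_sink (induced_subgraph (polytope_graph P) ?V) \<O>"
  let ?R = "\<O> \<inter> ?V \<times> ?V"
  have VF: "?V = vertices_of P \<inter> F" using vertices_of_face F by blast
  then have V: "?V \<subseteq> vertices_of P" by blast
  have ne: "?V \<noteq> {}" using vertices_of_nonempty pF F by blast
  have reach: "\<exists>t. ?sink t \<and> (x, t) \<in> ?R\<^sup>*" if "x \<in> ?V" for x
    using orientation_reaches_sink[OF pP O V that] by blast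
  \<comment> \<open>Well-founded induction along the arcs: the claim is assumed at all
    out-neighbours of \<open>x\<close> within \<open>F\<close> and proved at
    \<open>x\<close>.\<close>
  have uniq: "\<exists>!t. ?sink t \<and> (x, t) \<in> ?R\<^sup>*" if "x \<in> ?V" for x
    using wf_acyclic_orientation[OF pP O] that
  proof (induction x rule: wf_induct_rule)
    case (less x)
    have IH: "\<exists>!t. ?sink t \<and> (y, t) \<in> ?R\<^sup>*" if "(x, y) \<in> ?R" for y
      using less.IH[of y] that by blast
    have "s = t" if s: "?sink s" "(x, s) \<in> ?R\<^sup>*" and t: "?sink t" "(x, t) \<in> ?R\<^sup>*" for s t
    proof (cases "?sink x")
      case True
      have "(x, y) \<notin> ?R" for y
      proof
        assume "(x, y) \<in> ?R"
        then have "y \<in> neighbours P x \<inter> ?V" "(x, y) \<in> \<O>"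
          using acyclic_orientation_arc(1)[OF O] neighbours_sym by blast+
        then show False
          using True is_sink_induced_iff[OF V] acyclic_orientation_arc(2)[OF O] by blast
      qed
      then show ?thesis using s t by (metis converse_rtranclE)
    next
      case False
      then obtain y z where y: "(x, y) \<in> ?R" "(y, s) \<in> ?R\<^sup>*" and z: "(x, z) \<in> ?R" "(z, t) \<in> ?R\<^sup>*"
        using s t by (metis converse_rtranclE)
      show ?thesis
      proof (cases "y = z")
        case True
        then show ?thesis using IH[OF y(1)] y z s t by blast
      next
        case False
        have nb: "y \<in> neighbours P x" "z \<in> neighbours P x"
          using y z acyclic_orientation_arc(1)[OF O] neighbours_sym by blast+
        obtain G where G: "G face_of P" "aff_dim G = 2" "{x, y, z} \<subseteq> G"
          using two_face_exists[OF P nb False] .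
        have "{x, y, z} \<subseteq> F" using y z VF by blast
        then have GF: "G \<subseteq> F" using two_face_subset[OF P nb False G] F by blast
        let ?W = "vertices_of G"
        have VG: "?W = vertices_of P \<inter> G" using vertices_of_face G by blast
        have W: "?W \<subseteq> vertices_of P" "?W \<subseteq> ?V" "y \<in> ?W" "z \<in> ?W"
          using VG VF GF G y z V by auto
        let ?sinkG = "is_sink (induced_subgraph (polytope_graph P) ?W) \<O>"
        obtain p where p: "?sinkG p" "(y, p) \<in> (\<O> \<inter> ?W \<times> ?W)\<^sup>*"
          using orientation_reaches_sink[OF pP O W(1,3)] .
        obtain q where q: "?sinkG q" "(z, q) \<in> (\<O> \<inter> ?W \<times> ?W)\<^sup>*"
          using orientation_reaches_sink[OF pP O W(1,4)] .
        have "?W \<in> two_face_system P" using G by (auto simp: two_face_system_def)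
        then have [simp]: "q = p" using two p q by blast
        have "(\<O> \<inter> ?W \<times> ?W)\<^sup>* \<subseteq> ?R\<^sup>*" using W(2) by (intro rtrancl_mono) blast
        then have yz: "(y, p) \<in> ?R\<^sup>*" "(z, p) \<in> ?R\<^sup>*" using p q by auto
        have "p \<in> ?V" using p(1) is_sink_induced_iff[OF W(1)] W(2) by blast
        \<comment> \<open>The sink \<open>p\<close> of the 2-face is reachable from both
          \<open>y\<close> and \<open>z\<close>, and it leads on to a sink \<open>r\<close> of
          \<open>F\<close>. The induction hypotheses at \<open>y\<close> and at \<open>z\<close>
          then identify \<open>s\<close> and \<open>t\<close> with \<open>r\<close>.\<close>
        then obtain r where r: "?sink r" "(p, r) \<in> ?R\<^sup>*" using reach by blast
        have "(y, r) \<in> ?R\<^sup>*" "(z, r) \<in> ?R\<^sup>*" using yz r(2) by (meson rtrancl_trans)+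
        then have "s = r" using IH[OF y(1)] s(1) y(2) r(1) by blast
        moreover have "t = r" using IH[OF z(1)] t(1) z(2) r(1) \<open>(z, r) \<in> ?R\<^sup>*\<close> by blast
        ultimately show ?thesis by simp
      qed
    qed
    then show ?case using reach[OF less.prems] by blast
  qed
  \<comment> \<open>Adjacent vertices have the same normal form, and the graph of \<open>F\<close> is connected because
      a linear functional has no local maximum on \<open>F\<close> that is not global.\<close>
  define nf where "nf = (\<lambda>x. THE t. ?sink t \<and> (x, t) \<in> ?R\<^sup>*)"
  have nf: "?sink (nf x)" "(x, nf x) \<in> ?R\<^sup>*" if "x \<in> ?V" for x
    using theI'[OF uniq[OF that]] by (auto simp: nf_def)
  have nf_eq: "nf x = t" if "x \<in> ?V" "?sink t" "(x, t) \<in> ?R\<^sup>*" for x t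
    using uniq[OF that(1)] nf[OF that(1)] that by blast
  have step: "nf x = nf y" if "(x, y) \<in> ?R" for x y
    using that nf[of y] by (intro nf_eq) (auto intro: converse_rtrancl_into_rtrancl)
  have adj: "nf x = nf y" if "x \<in> ?V" "y \<in> neighbours F x" for x y
  proof -
    have "y \<in> neighbours P x" "y \<in> ?V"
      using that neighbours_face[of F P x] F VF neighbours_subset[of F x] by auto
    then have "(x, y) \<in> ?R \<or> (y, x) \<in> ?R"
      using acyclic_orientation_arc(2)[OF O] that by blast
    then show ?thesis using step by metis
  qed
  obtain c where c: "inj_on ((\<bullet>) c) ?V" using ex_inner_inj_on[OF finite_vertices[OF pF]] .
  obtain m where m: "m \<in> ?V" "\<And>x. x \<in> ?V \<Longrightarrow> c \<bullet> x \<le> c \<bullet> m"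
    using finite_arg_max[OF finite_vertices[OF pF] ne, of "(\<bullet>) c"] by blast
  \<comment> \<open>Among the vertices whose normal form differs from that of \<open>m\<close>, take
    \<open>y\<close> with largest \<open>c\<close>-value. By \<open>adj\<close> its neighbours in
    \<open>F\<close> are of the same kind, so \<open>y\<close> is a local and thus a global maximum,
    which forces \<open>y = m\<close>.\<close>
  have const: "nf x = nf m" if "x \<in> ?V" for x
  proof (rule ccontr)
    let ?X = "{x \<in> ?V. nf x \<noteq> nf m}"
    assume "nf x \<noteq> nf m"
    then have X: "finite ?X" "?X \<noteq> {}" using that finite_vertices[OF pF] by auto
    obtain y where y: "y \<in> ?X" "\<And>x. x \<in> ?X \<Longrightarrow> c \<bullet> x \<le> c \<bullet> y"
      using finite_arg_max[OF X, of "(\<bullet>) c"] by blast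
    have "c \<bullet> u \<le> c \<bullet> y" if u: "u \<in> neighbours F y" for u
      using adj[OF _ u] y(1) y(2)[of u] neighbours_subset[of F y] u by auto
    then have "c \<bullet> m \<le> c \<bullet> y"
      using local_max_vertex[OF pF, of y c m] y(1) m(1) VF by blast
    then have "y = m" using c m y(1) by (auto simp: inj_on_def intro: antisym)
    then show False using y(1) by simp
  qed
  show "\<exists>!v. ?sink v"
  proof (rule ex1I)
    show "?sink (nf m)" using nf m by blast
    fix t assume t: "?sink t"
    then have "t \<in> ?V" using is_sink_induced_iff[OF V] by blast
    then show "t = nf m" using nf_eq[OF _ t] const by fastforce
  qed
qed

section \<open>AOF-orientations as the minimisers of \<open>H2\<close>\<close>

lemma aof_orientation_iff_H2:
  fixes P :: "'a::euclidean_space set"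
  assumes P: "simple_polytope d P" and O: "acyclic_orientation (polytope_graph P) \<O>"
  shows "aof_orientation P \<O> \<longleftrightarrow> H2 d P \<O> = card (two_face_system P)"
proof -
  have "aof_orientation P \<O> \<longleftrightarrow>
      (\<forall>S\<in>two_face_system P. \<exists>!v. is_sink (induced_subgraph (polytope_graph P) S) \<O> v)"
  proof
    assume aof: "aof_orientation P \<O>"
    show "\<forall>S\<in>two_face_system P. \<exists>!v. is_sink (induced_subgraph (polytope_graph P) S) \<O> v"
    proof
      fix S assume "S \<in> two_face_system P"
      then obtain F where "F face_of P" "aff_dim F = 2" "S = vertices_of F"
        by (auto simp: two_face_system_def)
      moreover then have "F \<noteq> {}" by force
      ultimately show "\<exists>!v. is_sink (induced_subgraph (polytope_graph P) S) \<O> v"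
        using aof unfolding aof_orientation_def by blast
    qed
  qed (use unique_sinks_if_unique_sinks_two_faces[OF P O] in blast)
  also have "\<dots> \<longleftrightarrow> H2 d P \<O> = card (two_face_system P)"
    using two_system_H2(2)[OF P O two_system_two_faces[OF P]] by metis
  finally show ?thesis .
qed

theorem corollary4:
  fixes P :: "'a::euclidean_space set" and d :: nat and \<O> :: "('a \<times> 'a) set"
  assumes "simple_polytope d P" and "d \<ge> 3"
    and "acyclic_orientation (polytope_graph P) \<O>"
  shows "((\<exists>\<S>. two_system P \<S> \<and> card \<S> = H2 d P \<O>) \<noteq>
          (\<exists>\<O>'. acyclic_orientation (polytope_graph P) \<O>' \<and> H2 d P \<O>' < H2 d P \<O>)) \<and>
         ((\<exists>\<S>. two_system P \<S> \<and> card \<S> = H2 d P \<O>) \<longrightarrow> aof_orientation P \<O>) \<and>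
         ((\<exists>\<O>'. acyclic_orientation (polytope_graph P) \<O>' \<and> H2 d P \<O>' < H2 d P \<O>) \<longrightarrow>
            \<not> aof_orientation P \<O>)"
proof -
  let ?f = "card (two_face_system P)"
  note P = assms(1) and O = assms(3)
  have pP: "polytope P" using P by (simp add: simple_polytope_def)
  have upper: "card \<S> \<le> H2 d P \<O>'"
    if "two_system P \<S>" "acyclic_orientation (polytope_graph P) \<O>'" for \<S> \<O>'
    using two_system_H2(1)[OF P that(2,1)] .
  obtain c where "inj_on ((\<bullet>) c) (vertices_of P)"
    using ex_inner_inj_on[OF finite_vertices[OF pP]] .
  then have "aof_orientation P (linear_orientation P c)"
    by (rule aof_linear_orientation[OF pP])
  then obtain \<O>\<^sub>0 where O0: "acyclic_orientation (polytope_graph P) \<O>\<^sub>0" "H2 d P \<O>\<^sub>0 = ?f"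
    using aof_orientation_iff_H2[OF P] aof_orientation_def by blast
  have F: "two_system P (two_face_system P)" by (rule two_system_two_faces[OF P])
  \<comment> \<open>Any 2-system has at most \<open>H2 d P \<O>\<^sub>0 = ?f\<close> members, while
    the 2-faces give \<open>?f \<le> H2 d P \<O>\<close>; a 2-system of size
    \<open>H2 d P \<O>\<close> therefore forces equality.\<close>
  have a: "(\<exists>\<S>. two_system P \<S> \<and> card \<S> = H2 d P \<O>) \<longleftrightarrow> H2 d P \<O> = ?f"
    using upper[OF _ O0(1)] upper[OF F O] O0(2) F by (metis antisym)
  \<comment> \<open>The 2-faces bound \<open>H2\<close> from below by \<open>?f\<close> for every
    acyclic orientation, and \<open>\<O>\<^sub>0\<close> attains the bound.\<close>
  have b: "(\<exists>\<O>'. acyclic_orientation (polytope_graph P) \<O>' \<and> H2 d P \<O>' < H2 d P \<O>) \<longleftrightarrow>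
      H2 d P \<O> \<noteq> ?f"
    using upper[OF F] O O0 by (metis le_neq_implies_less linorder_not_less)
  show ?thesis unfolding a b using aof_orientation_iff_H2[OF P O] by blast
qed

end
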